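(* Let $P\colon(\mathsf X,F)\to(\mathsf M,G)$ be a fibrewise opfibration over a category $\mathsf B$ such that all the fibres of $P$ are groupoids. Let $x$ and $y$ be objects of $\mathsf X$, let $\varphi\colon P(x)\to P(y)$ be a morphism of $\mathsf M$, and let $\varphi^*y$ and $\varphi_*x$ be the objects of $\mathsf X$ defined in the context (both lie in the fibre of $P$ over $P(\varphi^*y)$). Let $\mathsf X_\varphi(x,y)$ be the set of morphisms $f\colon x\to y$ of $\mathsf X$ with $P(f)=\varphi$. Then: (i) $\mathsf X_\varphi(x,y)\neq\emptyset$ if and only if $\varphi^*y\cong\varphi_*x$ in the fibre of $P$ over $P(\varphi^*y)$. (ii) If this is the case, then $\mathsf X_\varphi(x,y)$ is a simply transitive $H$-set (i.e. an $H$-torsor), where the acting group is $$H=\mathsf X_{P(\varphi^*y)}(\varphi^*y,\varphi^*y),$$ the group of automorphisms of $\varphi^*y$ in the fibre of $P$ over $P(\varphi^*y)$.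
   Context: Composition is written $f\cdot g$ ($g$ first). For a functor $P\colon\mathsf X\to\mathsf B$, a morphism $f\colon x\to y$ is $P$-cartesian if for all $\alpha\colon a'\to P(x)$ and $f'\colon x'\to y$ with $P(f')=P(f)\cdot\alpha$ there is a unique $\hat\alpha\colon x'\to x$ with $P(\hat\alpha)=\alpha$ and $f'=f\cdot\hat\alpha$. $P$ is a fibration if for every $\varphi\colon a\to b$ in $\mathsf B$ and every $y$ with $P(y)=b$ there is a $P$-cartesian $f\colon x\to y$ with $P(f)=\varphi$ (a cartesian lifting of $\varphi$ at $y$). Opcartesian morphisms and opfibrations are the dual notions. The fibre $\mathsf X_b$ is the subcategory of all morphisms $g$ with $P(g)=1_b$. For objects $x',x$ and $\alpha\colon P(x')\to P(x)$, $\mathsf X_\alpha(x',x)$ is the set of morphisms $h\colon x'\to x$ with $P(h)=\alpha$; for an object $m$ of $\mathsf M$ and $x',x$ in the fibre of $P$ over $m$, $\mathsf X_m(x',x)$ is the hom-set in that fibre. A morphism $P\colon(\mathsf X,F)\to(\mathsf M,G)$ in $\mathsf{Fib}(\mathsf B)$ consists of fibrations $F\colon\mathsf X\to\mathsf B$, $G\colon\mathsf M\to\mathsf B$ and a functor $P\colon\mathsf X\to\mathsf M$ with $G\cdot P=F$ which sends $F$-cartesian morphisms to $G$-cartesian ones. It is a fibrewise opfibration if for every object $b$ of $\mathsf B$ the restriction $P_b\colon\mathsf X_b\to\mathsf M_b$ to the fibres of $F$ and $G$ over $b$ is an opfibration. Given $x,y$ in $\mathsf X$ and $\varphi\colon P(x)\to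 P(y)$: choose an $F$-cartesian lifting $w\colon\varphi^*y\to y$ of $G(\varphi)$ at $y$. Then $\varphi_k=P(w)$ is $G$-cartesian, so $\varphi=\varphi_k\cdot\varphi_v$ for a unique $\varphi_v\colon P(x)\to P(\varphi^*y)$ in the fibre $\mathsf M_{F(x)}$. Choose a $P_{F(x)}$-opcartesian lifting $u\colon x\to\varphi_*x$ of $\varphi_v$ at $x$; thus $P(\varphi_*x)=P(\varphi^*y)$. The $H$-action in (ii) is the one induced by left composition of arrows on $\mathsf X_{P(\varphi^*y)}(\varphi_*x,\varphi^*y)$, transported along the map $g\mapsto w\cdot g\cdot u$ to $\mathsf X_\varphi(x,y)$. *)

theory Defs
  imports "HOL-Algebra.Group_Action"
begin

section \<open>Categories and functors\<close>

record ('o, 'm) category =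
  Obj :: "'o set"
  Mor :: "'m set"
  Dom :: "'m \<Rightarrow> 'o"
  Cod :: "'m \<Rightarrow> 'o"
  Ident :: "'o \<Rightarrow> 'm"
  Comp :: "'m \<Rightarrow> 'm \<Rightarrow> 'm"  (infixr "\<cdot>\<index>" 75)

definition Hom :: "('o, 'm) category \<Rightarrow> 'o \<Rightarrow> 'o \<Rightarrow> 'm set"
  where "Hom C x y = {f \<in> Mor C. Dom C f = x \<and> Cod C f = y}"

locale category =
  fixes C :: "('o, 'm) category"
  assumes Dom_closed: "f \<in> Mor C \<Longrightarrow> Dom C f \<in> Obj C"
    and Cod_closed: "f \<in> Mor C \<Longrightarrow> Cod C f \<in> Obj C"
    and Id_in_Hom: "x \<in> Obj C \<Longrightarrow> Ident C x \<in> Hom C x x"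
    and Comp_in_Hom: "g \<in> Hom C x y \<Longrightarrow> f \<in> Hom C y z \<Longrightarrow> f \<cdot>\<^bsub>C\<^esub> g \<in> Hom C x z"
    and Comp_Id: "f \<in> Hom C x y \<Longrightarrow> f \<cdot>\<^bsub>C\<^esub> Ident C x = f"
    and Id_Comp: "f \<in> Hom C x y \<Longrightarrow> Ident C y \<cdot>\<^bsub>C\<^esub> f = f"
    and Comp_assoc: "h \<in> Hom C w x \<Longrightarrow> g \<in> Hom C x y \<Longrightarrow> f \<in> Hom C y z \<Longrightarrow>
           (f \<cdot>\<^bsub>C\<^esub> g) \<cdot>\<^bsub>C\<^esub> h = f \<cdot>\<^bsub>C\<^esub> (g \<cdot>\<^bsub>C\<^esub> h)"

definition op_category :: "('o, 'm) category \<Rightarrow> ('o, 'm) category"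
  where "op_category C =
    \<lparr>Obj = Obj C, Mor = Mor C, Dom = Cod C, Cod = Dom C, Ident = Ident C, Comp = (\<lambda>f g. g \<cdot>\<^bsub>C\<^esub> f)\<rparr>"

definition is_iso :: "('o, 'm) category \<Rightarrow> 'm \<Rightarrow> bool"
  where "is_iso C f \<longleftrightarrow> f \<in> Mor C \<and>
    (\<exists>g \<in> Hom C (Cod C f) (Dom C f).
       g \<cdot>\<^bsub>C\<^esub> f = Ident C (Dom C f) \<and> f \<cdot>\<^bsub>C\<^esub> g = Ident C (Cod C f))"

definition isomorphic :: "('o, 'm) category \<Rightarrow> 'o \<Rightarrow> 'o \<Rightarrow> bool"
  where "isomorphic C x y \<longleftrightarrow> (\<exists>f \<in> Hom C x y. is_iso C f)"

locale groupoid = category +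
  assumes all_iso: "f \<in> Mor C \<Longrightarrow> is_iso C f"

text \<open>Only the values of a functor on the objects and morphisms of its source category matter.
  Hence the same record also denotes its restriction to a subcategory, and its opposite.\<close>

record ('o1, 'm1, 'o2, 'm2) ftor =
  omap :: "'o1 \<Rightarrow> 'o2"
  mmap :: "'m1 \<Rightarrow> 'm2"

locale cat_functor = source: category C + target: category D
  for C :: "('o1, 'm1) category" and D :: "('o2, 'm2) category"
    and F :: "('o1, 'm1, 'o2, 'm2) ftor" +
  assumes omap_closed: "x \<in> Obj C \<Longrightarrow> omap F x \<in> Obj D"
    and mmap_in_Hom: "f \<in> Hom C x y \<Longrightarrow> mmap F f \<in> Hom D (omap F x) (omap F y)"
    and mmap_Id: "x \<in> Obj C \<Longrightarrow> mmap F (Ident C x) = Ident D (omap F x)"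
    and mmap_Comp: "g \<in> Hom C x y \<Longrightarrow> f \<in> Hom C y z \<Longrightarrow>
           mmap F (f \<cdot>\<^bsub>C\<^esub> g) = mmap F f \<cdot>\<^bsub>D\<^esub> mmap F g"


section \<open>Fibrations\<close>

definition Hom_over ::
    "('o1, 'm1) category \<Rightarrow> ('o1, 'm1, 'o2, 'm2) ftor \<Rightarrow> 'm2 \<Rightarrow> 'o1 \<Rightarrow> 'o1 \<Rightarrow> 'm1 set"
  where "Hom_over X P \<alpha> x' x = {h \<in> Hom X x' x. mmap P h = \<alpha>}"

definition fibre ::
    "('o1, 'm1) category \<Rightarrow> ('o2, 'm2) category \<Rightarrow> ('o1, 'm1, 'o2, 'm2) ftor \<Rightarrow> 'o2
      \<Rightarrow> ('o1, 'm1) category"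
  where "fibre X B P b =
    \<lparr>Obj = {x \<in> Obj X. omap P x = b}, Mor = {g \<in> Mor X. mmap P g = Ident B b},
     Dom = Dom X, Cod = Cod X, Ident = Ident X, Comp = Comp X\<rparr>"

text \<open>That \<open>\<alpha>\<close> starts at \<open>P(x')\<close>, where \<open>x'\<close> is the domain of \<open>f'\<close>, follows from
  \<open>P(f') = P(f) \<cdot> \<alpha>\<close>.\<close>

definition cartesian ::
    "('o1, 'm1) category \<Rightarrow> ('o2, 'm2) category \<Rightarrow> ('o1, 'm1, 'o2, 'm2) ftor \<Rightarrow> 'm1 \<Rightarrow> bool"
  where "cartesian X B P f \<longleftrightarrow> f \<in> Mor X \<and>
    (\<forall>\<alpha> \<in> Mor B. \<forall>f' \<in> Mor X.
       Cod B \<alpha> = omap P (Dom X f) \<and> Cod X f' = Cod X f \<and> mmap P f' = mmap P f \<cdot>\<^bsub>B\<^esub> \<alpha> \<longrightarrow>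
       (\<exists>!h. h \<in> Hom X (Dom X f') (Dom X f) \<and> mmap P h = \<alpha> \<and> f' = f \<cdot>\<^bsub>X\<^esub> h))"

locale fibration = cat_functor X B P
  for X :: "('o1, 'm1) category" and B :: "('o2, 'm2) category"
    and P :: "('o1, 'm1, 'o2, 'm2) ftor" +
  assumes cartesian_lifting: "\<phi> \<in> Hom B a b \<Longrightarrow> y \<in> Obj X \<Longrightarrow> omap P y = b \<Longrightarrow>
    \<exists>x. \<exists>f \<in> Hom X x y. cartesian X B P f \<and> mmap P f = \<phi>"

definition opcartesian ::
    "('o1, 'm1) category \<Rightarrow> ('o2, 'm2) category \<Rightarrow> ('o1, 'm1, 'o2, 'm2) ftor \<Rightarrow> 'm1 \<Rightarrow> bool"
  where "opcartesian X B P f \<longleftrightarrow> cartesian (op_category X) (op_category B) P f"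

definition opfibration ::
    "('o1, 'm1) category \<Rightarrow> ('o2, 'm2) category \<Rightarrow> ('o1, 'm1, 'o2, 'm2) ftor \<Rightarrow> bool"
  where "opfibration X B P \<longleftrightarrow> fibration (op_category X) (op_category B) P"

locale fib_morphism =
  cat_functor X M P + total: fibration X B F + base: fibration M B G
  for B :: "('ob, 'mb) category"
    and X :: "('ox, 'mx) category" and F :: "('ox, 'mx, 'ob, 'mb) ftor"
    and M :: "('om, 'mm) category" and G :: "('om, 'mm, 'ob, 'mb) ftor"
    and P :: "('ox, 'mx, 'om, 'mm) ftor" +
  assumes omap_commute: "x \<in> Obj X \<Longrightarrow> omap G (omap P x) = omap F x"
    and mmap_commute: "f \<in> Mor X \<Longrightarrow> mmap G (mmap P f) = mmap F f"
    and preserves_cartesian: "cartesian X B F f \<Longrightarrow> cartesian M B G (mmap P f)"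

locale fibrewise_opfibration = fib_morphism +
  assumes fibre_opfibration: "b \<in> Obj B \<Longrightarrow> opfibration (fibre X B F b) (fibre M B G b) P"


section \<open>Torsors\<close>

definition endo_monoid :: "('o, 'm) category \<Rightarrow> 'o \<Rightarrow> 'm monoid"
  where "endo_monoid C x = \<lparr>carrier = Hom C x x, mult = Comp C, one = Ident C x\<rparr>"

locale torsor = transitive_action +
  assumes nonempty: "E \<noteq> {}"
    and free: "x \<in> E \<Longrightarrow> stabilizer G \<phi> x = {\<one>}"

text \<open>Actions on a set \<open>E\<close> are functions into \<open>Bij E\<close>, hence extensional on \<open>E\<close>.\<close>

definition left_comp_action :: "('o, 'm) category \<Rightarrow> 'o \<Rightarrow> 'o \<Rightarrow> 'm \<Rightarrow> 'm \<Rightarrow> 'm"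
  where "left_comp_action C x y h = (\<lambda>g \<in> Hom C x y. h \<cdot>\<^bsub>C\<^esub> g)"

text \<open>Transport of an action on \<open>S\<close> along a bijection \<open>\<tau>\<close> from \<open>S\<close> onto \<open>E\<close>.\<close>

definition transport_action ::
    "('s \<Rightarrow> 'e) \<Rightarrow> 's set \<Rightarrow> 'e set \<Rightarrow> ('g \<Rightarrow> 's \<Rightarrow> 's) \<Rightarrow> 'g \<Rightarrow> 'e \<Rightarrow> 'e"
  where "transport_action \<tau> S E \<rho> h = (\<lambda>e \<in> E. \<tau> (\<rho> h (inv_into S \<tau> e)))"

end

theory Submission
  imports Defs
begin

text \<open>Cartesianness of \<open>w\<close> factors every morphism over \<open>\<phi>\<close> uniquely as \<open>w \<cdot> k\<close> with \<open>k\<close> over an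
  identity of \<open>B\<close>; since \<open>P(w)\<close> is cartesian too, \<open>k\<close> lies over \<open>\<phi>\<^sub>v\<close>, so it factors uniquely as
  \<open>g \<cdot> u\<close> by opcartesianness of \<open>u\<close>. Thus \<open>g \<mapsto> w \<cdot> g \<cdot> u\<close> is a bijection, and everything reduces to
  the fact that in a groupoid every nonempty hom-set is a torsor under the automorphism group of
  its codomain.\<close>

section \<open>Torsors\<close>

text \<open>The elementwise laws suffice because they make \<open>\<rho> (inv g)\<close> a two-sided
  inverse of \<open>\<rho> g\<close> on \<open>E\<close>. Extensionality is asked for separately
  because \<open>BijGroup E\<close> contains only extensional bijections.\<close>

lemma torsorI:
  fixes G (structure)
  assumes "group G"
    and ext: "\<And>g. g \<in> carrier G \<Longrightarrow> \<rho> g \<in> extensional E"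
    and closed: "\<And>g e. g \<in> carrier G \<Longrightarrow> e \<in> E \<Longrightarrow> \<rho> g e \<in> E"
    and one: "\<And>e. e \<in> E \<Longrightarrow> \<rho> \<one> e = e"
    and mult: "\<And>g h e. g \<in> carrier G \<Longrightarrow> h \<in> carrier G \<Longrightarrow> e \<in> E \<Longrightarrow> \<rho> (g \<otimes> h) e = \<rho> g (\<rho> h e)"
    and trans: "\<And>e e'. e \<in> E \<Longrightarrow> e' \<in> E \<Longrightarrow> \<exists>g \<in> carrier G. \<rho> g e = e'"
    and free: "\<And>g e. g \<in> carrier G \<Longrightarrow> e \<in> E \<Longrightarrow> \<rho> g e = e \<Longrightarrow> g = \<one>"
    and "E \<noteq> {}"
  shows "torsor G E \<rho>"
proof -
  interpret group G by fact
  have Bij: "\<rho> g \<in> Bij E" if g: "g \<in> carrier G" for g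
  proof -
    have "\<rho> g (\<rho> (inv g) e) = e" "\<rho> (inv g) (\<rho> g e) = e" if "e \<in> E" for e
      using that g by (simp_all flip: mult add: one)
    then have "bij_betw (\<rho> g) E E"
      using closed g by (intro bij_betw_byWitness[where f' = "\<rho> (inv g)"]) auto
    then show ?thesis
      by (simp add: Bij_def ext g)
  qed
  have "\<rho> (g \<otimes> h) = compose E (\<rho> g) (\<rho> h)" if "g \<in> carrier G" "h \<in> carrier G" for g h
    using that by (intro extensionalityI[where A = E]) (auto simp: ext mult compose_eq)
  then have "\<rho> \<in> hom G (BijGroup E)"
    by (auto simp: hom_def BijGroup_def Bij)
  then have "group_hom G (BijGroup E) \<rho>"
    by (intro group_hom.intro group_hom_axioms.intro group_BijGroup is_group)
  moreover have "stabilizer G \<rho> e = {\<one>}" if "e \<in> E" for e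
    using that free one by (auto simp: stabilizer_def)
  ultimately show ?thesis
    using trans \<open>E \<noteq> {}\<close>
    by (intro torsor.intro transitive_action.intro group_action.intro
        transitive_action_axioms.intro torsor_axioms.intro)
qed

text \<open>Each law is checked on \<open>S\<close> after pulling back along
  \<open>inv_into S \<tau>\<close>, which cancels against \<open>\<tau>\<close> on either
  side.\<close>

lemma torsor_transport:
  fixes G (structure)
  assumes "torsor G S \<rho>" and bij: "bij_betw \<tau> S E"
  shows "torsor G E (transport_action \<tau> S E \<rho>)"
proof -
  interpret torsor G S \<rho> by fact
  interpret group_hom G "BijGroup S" \<rho> by (rule group_hom)
  let ?\<sigma> = "inv_into S \<tau>"
  have \<sigma>: "?\<sigma> e \<in> S" "\<tau> (?\<sigma> e) = e" if "e \<in> E" for e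
    using bij that by (auto simp: bij_betw_def inv_into_into f_inv_into_f)
  have \<tau>: "\<tau> s \<in> E" "?\<sigma> (\<tau> s) = s" if "s \<in> S" for s
    using bij that by (auto simp: bij_betw_def)
  have \<rho>: "\<rho> g s \<in> S" if "g \<in> carrier G" "s \<in> S" for g s
    using element_image that by blast
  show ?thesis
  proof (rule torsorI)
    show "\<exists>g \<in> carrier G. transport_action \<tau> S E \<rho> g e = e'" if "e \<in> E" "e' \<in> E" for e e'
      using unique_orbit[of "?\<sigma> e" "?\<sigma> e'"] that by (metis \<sigma> restrict_apply' transport_action_def)
    show "g = \<one>" if "g \<in> carrier G" "e \<in> E" "transport_action \<tau> S E \<rho> g e = e" for g e
    proof -
      have "\<rho> g (?\<sigma> e) = ?\<sigma> e"
        using that \<tau>(2)[OF \<rho>] by (metis \<sigma>(1) restrict_apply' transport_action_def)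
      then have "g \<in> stabilizer G \<rho> (?\<sigma> e)"
        using that by (simp add: stabilizer_def)
      then show ?thesis
        using free \<sigma>(1) that by blast
    qed
    show "transport_action \<tau> S E \<rho> \<one> e = e" if "e \<in> E" for e
      using that fun_cong[OF id_eq_one, of "?\<sigma> e"] by (simp add: transport_action_def \<sigma>)
    show "E \<noteq> {}"
      using nonempty \<tau> by blast
  \<comment> \<open>With \<open>hom_mult\<close> active, the action of a product would turn into a
    product in \<open>BijGroup S\<close> before \<open>composition_rule\<close> could apply.\<close>
  qed (auto simp: transport_action_def \<sigma> \<tau> \<rho> composition_rule simp del: hom_mult)
qed


section \<open>Groupoids\<close>

lemma (in groupoid) Hom_inverse:
  assumes "f \<in> Hom C x y"
  obtains g where "g \<in> Hom C y x" "g \<cdot>\<^bsub>C\<^esub> f = Ident C x" "f \<cdot>\<^bsub>C\<^esub> g = Ident C y"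
  using all_iso[of f] assms unfolding is_iso_def Hom_def by auto

text \<open>Every arrow can be inverted, so the direction of the hom-set is free. The reversed one
  matches the arrows from \<open>x_push\<close> to \<open>y_pull\<close> against an isomorphism from
  \<open>y_pull\<close> to \<open>x_push\<close>.\<close>

lemma (in groupoid) isomorphic_iff_Hom_nonempty: "isomorphic C x y \<longleftrightarrow> Hom C y x \<noteq> {}"
  unfolding isomorphic_def
  using Hom_inverse all_iso by (metis (no_types, lifting) Hom_def empty_iff ex_in_conv mem_Collect_eq)

lemma (in groupoid) group_endo_monoid:
  assumes "x \<in> Obj C"
  shows "group (endo_monoid C x)"
proof (rule groupI)
  show "\<exists>g \<in> carrier (endo_monoid C x). g \<otimes>\<^bsub>endo_monoid C x\<^esub> f = \<one>\<^bsub>endo_monoid C x\<^esub>"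
    if f: "f \<in> carrier (endo_monoid C x)" for f
    using Hom_inverse[of f x x] f by (auto simp: endo_monoid_def)
qed (use assms in \<open>auto simp: endo_monoid_def Id_in_Hom Id_Comp intro: Comp_in_Hom Comp_assoc\<close>)

text \<open>Transitivity: composing \<open>e'\<close> with the inverse of \<open>e\<close> gives the
  element that carries \<open>e\<close> to \<open>e'\<close>. Freeness: if \<open>g\<close> fixes
  \<open>e\<close>, cancelling \<open>e\<close> on the right leaves \<open>g\<close> equal to the
  identity.\<close>

lemma (in groupoid) torsor_left_comp_action:
  assumes "Hom C x y \<noteq> {}"
  shows "torsor (endo_monoid C y) (Hom C x y) (left_comp_action C x y)"
proof (rule torsorI)
  have y: "y \<in> Obj C"
    using assms Cod_closed by (auto simp: Hom_def)
  show "group (endo_monoid C y)"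
    by (rule group_endo_monoid) fact
  show "left_comp_action C x y \<one>\<^bsub>endo_monoid C y\<^esub> e = e" if "e \<in> Hom C x y" for e
    using that by (simp add: left_comp_action_def endo_monoid_def Id_Comp)
  show "\<exists>g \<in> carrier (endo_monoid C y). left_comp_action C x y g e = e'"
    if e: "e \<in> Hom C x y" and e': "e' \<in> Hom C x y" for e e'
  proof -
    obtain i where i: "i \<in> Hom C y x" "i \<cdot>\<^bsub>C\<^esub> e = Ident C x"
      using e by (rule Hom_inverse)
    have "(e' \<cdot>\<^bsub>C\<^esub> i) \<cdot>\<^bsub>C\<^esub> e = e'"
      using e' Comp_assoc[OF e i(1) e'] i(2) Comp_Id by simp
    moreover have "e' \<cdot>\<^bsub>C\<^esub> i \<in> Hom C y y"
      using i(1) e' by (rule Comp_in_Hom)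
    ultimately show ?thesis
      using e by (auto simp: left_comp_action_def endo_monoid_def)
  qed
  show "g = \<one>\<^bsub>endo_monoid C y\<^esub>"
    if g: "g \<in> carrier (endo_monoid C y)" and e: "e \<in> Hom C x y"
      and eq: "left_comp_action C x y g e = e" for g e
  proof -
    obtain i where i: "i \<in> Hom C y x" "e \<cdot>\<^bsub>C\<^esub> i = Ident C y"
      using e by (rule Hom_inverse)
    have "g \<in> Hom C y y" "g \<cdot>\<^bsub>C\<^esub> e = e"
      using g e eq by (auto simp: endo_monoid_def left_comp_action_def)
    then show ?thesis
      using Comp_assoc[OF i(1) e, of g y] i(2) Comp_Id by (simp add: endo_monoid_def)
  qed
qed (use assms in \<open>auto simp: left_comp_action_def endo_monoid_def Comp_assoc intro: Comp_in_Hom\<close>)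


section \<open>Fibres and (op)cartesian factorizations\<close>

lemma Hom_fibre: "Hom (fibre X B P b) x y = Hom_over X P (Ident B b) x y"
  by (auto simp: Hom_def Hom_over_def fibre_def)

lemma Comp_fibre [simp]: "Comp (fibre X B P b) = Comp X"
  by (simp add: fibre_def)

lemma cartesianD:
  assumes "cartesian X B P f" "f \<in> Hom X x y" "\<alpha> \<in> Hom B a (omap P x)"
    and "f' \<in> Hom_over X P (mmap P f \<cdot>\<^bsub>B\<^esub> \<alpha>) x' y"
  shows "\<exists>!h. h \<in> Hom_over X P \<alpha> x' x \<and> f' = f \<cdot>\<^bsub>X\<^esub> h"
proof -
  have "f \<in> Mor X" "Dom X f = x" "Cod X f = y" "\<alpha> \<in> Mor B" "Cod B \<alpha> = omap P x"
      "f' \<in> Mor X" "Dom X f' = x'" "Cod X f' = y" "mmap P f' = mmap P f \<cdot>\<^bsub>B\<^esub> \<alpha>"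
    using assms(2-4) by (auto simp: Hom_def Hom_over_def)
  then show ?thesis
    using assms(1) unfolding cartesian_def Hom_over_def mem_Collect_eq conj_assoc by metis
qed

text \<open>Reversing all arrows only swaps the endpoints in \<open>Hom_over\<close>, so this is
  \<open>cartesianD\<close> in the opposite categories.\<close>

lemma opcartesianD:
  assumes "opcartesian X B P f" "f \<in> Hom X x y" "\<alpha> \<in> Hom B (omap P y) b"
    and "f' \<in> Hom_over X P (\<alpha> \<cdot>\<^bsub>B\<^esub> mmap P f) x y'"
  shows "\<exists>!h. h \<in> Hom_over X P \<alpha> y y' \<and> f' = h \<cdot>\<^bsub>X\<^esub> f"
proof -
  have eq: "Hom_over (op_category X) P \<beta> r s = Hom_over X P \<beta> s r" for \<beta> r s
    by (auto simp: Hom_over_def Hom_def op_category_def)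
  show ?thesis
    using cartesianD[of "op_category X" "op_category B" P f y x \<alpha> b f' y'] assms
    unfolding opcartesian_def eq by (simp add: Hom_def op_category_def conj_commute)
qed

lemma (in cat_functor) Hom_over_Comp:
  assumes "g \<in> Hom_over C F \<alpha> x y" "f \<in> Hom_over C F \<beta> y z"
  shows "f \<cdot>\<^bsub>C\<^esub> g \<in> Hom_over C F (\<beta> \<cdot>\<^bsub>D\<^esub> \<alpha>) x z"
  using assms source.Comp_in_Hom mmap_Comp by (auto simp: Hom_over_def)

text \<open>The cartesian arrow \<open>w\<close> gives a unique factor over
  \<open>Ident B b\<close>. That factor lies over \<open>\<psi>\<close>: its image under
  \<open>P\<close> and \<open>\<psi>\<close> both lie over \<open>Ident B b\<close> and have the
  same composite with \<open>mmap P w\<close>, which is again cartesian.\<close>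

lemma (in fib_morphism) cartesian_factorization:
  assumes w: "w \<in> Hom X y' y" "cartesian X B F w"
    and \<psi>: "\<psi> \<in> Hom (fibre M B G b) (omap P x) (omap P y')"
    and x: "x \<in> Obj X" "omap F x = b"
    and f: "f \<in> Hom_over X P (mmap P w \<cdot>\<^bsub>M\<^esub> \<psi>) x y"
  shows "\<exists>!k. k \<in> Hom_over X P \<psi> x y' \<and> f = w \<cdot>\<^bsub>X\<^esub> k"
proof -
  have y': "y' \<in> Obj X"
    using w(1) source.Dom_closed by (auto simp: Hom_def)
  have \<psi>M: "\<psi> \<in> Hom M (omap P x) (omap P y')" and \<psi>G: "mmap G \<psi> = Ident B b"
    using \<psi> by (auto simp: Hom_fibre Hom_over_def)
  have fX: "f \<in> Hom X x y" and Pf: "mmap P f = mmap P w \<cdot>\<^bsub>M\<^esub> \<psi>"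
    using f by (auto simp: Hom_over_def)
  have Pw: "mmap P w \<in> Hom M (omap P y') (omap P y)"
    using w(1) by (rule mmap_in_Hom)
  \<comment> \<open>That \<open>Ident B b\<close> ends at \<open>omap F y'\<close> is read off from
    \<open>mmap G \<psi>\<close>, since \<open>\<psi>\<close> ends at
    \<open>omap P y'\<close>.\<close>
  have \<alpha>: "Ident B b \<in> Hom B b (omap F y')"
    using base.mmap_in_Hom[OF \<psi>M] \<psi>G omap_commute x y' by simp
  have over_\<psi>: "mmap P k = \<psi>"
    if k: "k \<in> Hom X x y'" "mmap F k = Ident B b" and eq: "mmap P w \<cdot>\<^bsub>M\<^esub> mmap P k = mmap P w \<cdot>\<^bsub>M\<^esub> \<psi>" for k
  proof -
    let ?f = "mmap P w \<cdot>\<^bsub>M\<^esub> \<psi>"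
    have Pk: "mmap P k \<in> Hom M (omap P x) (omap P y')"
      using k(1) by (rule mmap_in_Hom)
    have Gk: "mmap G (mmap P k) = Ident B b"
      using k mmap_commute by (auto simp: Hom_def)
    have "?f \<in> Hom_over M G (mmap G (mmap P w) \<cdot>\<^bsub>B\<^esub> Ident B b) (omap P x) (omap P y)"
      using \<psi>M \<psi>G Pw by (intro base.Hom_over_Comp) (auto simp: Hom_over_def)
    from cartesianD[OF preserves_cartesian[OF w(2)] Pw _ this]
    have "\<exists>!h. h \<in> Hom_over M G (Ident B b) (omap P x) (omap P y') \<and> ?f = mmap P w \<cdot>\<^bsub>M\<^esub> h"
      using \<alpha> by (simp add: omap_commute y')
    moreover have "mmap P k \<in> Hom_over M G (Ident B b) (omap P x) (omap P y')"
        "\<psi> \<in> Hom_over M G (Ident B b) (omap P x) (omap P y')"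
      using Pk Gk \<psi>M \<psi>G by (simp_all add: Hom_over_def)
    ultimately show ?thesis
      using eq by metis
  qed
  \<comment> \<open>\<open>F\<close> is evaluated on \<open>f\<close> through \<open>G\<close> after
    \<open>P\<close>, because the given factorization is one of \<open>mmap P f\<close> in
    \<open>M\<close>.\<close>
  have "mmap F f = mmap F w \<cdot>\<^bsub>B\<^esub> Ident B b"
    using base.mmap_Comp[OF \<psi>M Pw] mmap_commute[of f] mmap_commute[of w] fX w(1) Pf \<psi>G
    by (auto simp: Hom_def)
  then have "\<exists>!h. h \<in> Hom_over X F (Ident B b) x y' \<and> f = w \<cdot>\<^bsub>X\<^esub> h"
    using cartesianD[OF w(2,1) \<alpha>] fX by (simp add: Hom_over_def)
  \<comment> \<open>Once \<open>f\<close> factors through \<open>w\<close> by \<open>h\<close>,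
    lying over \<open>Ident B b\<close> and lying over \<open>\<psi>\<close> are equivalent for
    \<open>h\<close>, so unique existence carries over.\<close>
  moreover have "h \<in> Hom_over X F (Ident B b) x y' \<longleftrightarrow> h \<in> Hom_over X P \<psi> x y'"
    if "f = w \<cdot>\<^bsub>X\<^esub> h" for h
  proof
    assume "h \<in> Hom_over X F (Ident B b) x y'"
    then have "h \<in> Hom X x y'" "mmap F h = Ident B b"
      by (simp_all add: Hom_over_def)
    moreover have "mmap P w \<cdot>\<^bsub>M\<^esub> mmap P h = mmap P w \<cdot>\<^bsub>M\<^esub> \<psi>"
      using mmap_Comp[OF calculation(1) w(1)] Pf that by simp
    ultimately show "h \<in> Hom_over X P \<psi> x y'"
      using over_\<psi> by (simp add: Hom_over_def)
  next
    assume "h \<in> Hom_over X P \<psi> x y'"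
    then show "h \<in> Hom_over X F (Ident B b) x y'"
      using mmap_commute[of h] \<psi>G by (auto simp: Hom_over_def Hom_def)
  qed
  ultimately show ?thesis
    by metis
qed

text \<open>Since \<open>y'\<close> and \<open>x'\<close> have the same image under
  \<open>P\<close>, the universal property of \<open>u\<close> can be applied to the identity of
  \<open>omap P y'\<close>: its composite with \<open>mmap P u\<close> is \<open>mmap P u\<close>,
  over which \<open>k\<close> lies.\<close>

lemma (in fib_morphism) opcartesian_factorization:
  assumes u: "u \<in> Hom (fibre X B F b) x x'"
      "opcartesian (fibre X B F b) (fibre M B G b) P u"
    and b: "omap F x = b"
    and y': "y' \<in> Obj X" "omap P y' = omap P x'"
    and k: "k \<in> Hom_over X P (mmap P u) x y'"
  shows "\<exists>!g. g \<in> Hom (fibre X M P (omap P y')) x' y' \<and> k = g \<cdot>\<^bsub>X\<^esub> u"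
proof -
  let ?id = "Ident M (omap P y')"
  have u': "u \<in> Hom X x x'" "mmap F u = Ident B b"
    using u(1) by (auto simp: Hom_fibre Hom_over_def)
  have x: "x \<in> Obj X" and x': "x' \<in> Obj X"
    using u'(1) source.Dom_closed source.Cod_closed by (auto simp: Hom_def)
  have Py': "omap P y' \<in> Obj M"
    using y'(1) by (rule omap_closed)
  \<comment> \<open>The arrow \<open>mmap F u\<close> ends at \<open>omap F x'\<close> and, being
    the identity of \<open>b\<close>, also at \<open>b\<close>.\<close>
  have Fx': "omap F x' = b"
    using total.mmap_in_Hom[OF u'(1)] u'(2) total.target.Id_in_Hom[of b] total.omap_closed[OF x] b
    by (auto simp: Hom_def)
  have G1: "mmap G ?id = Ident B b"
    using base.mmap_Id[OF Py'] omap_commute x' y' Fx' by simp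
  have \<alpha>: "?id \<in> Hom (fibre M B G b) (omap P x') (omap P y')"
    using target.Id_in_Hom[OF Py'] y'(2) G1 by (simp add: Hom_fibre Hom_over_def)
  have "?id \<cdot>\<^bsub>M\<^esub> mmap P u = mmap P u"
    using target.Id_Comp mmap_in_Hom[OF u'(1)] y'(2) by simp
  moreover have "mmap F k = Ident B b"
    using k u' mmap_commute[of k] mmap_commute[of u] by (auto simp: Hom_over_def Hom_def)
  ultimately have "k \<in> Hom_over (fibre X B F b) P (?id \<cdot>\<^bsub>M\<^esub> mmap P u) x y'"
    using k by (simp add: Hom_over_def Hom_fibre[unfolded Hom_over_def])
  then have "\<exists>!g. g \<in> Hom_over (fibre X B F b) P ?id x' y' \<and> k = g \<cdot>\<^bsub>X\<^esub> u"
    using opcartesianD[OF u(2,1) \<alpha>] by simp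
  \<comment> \<open>An arrow over \<open>?id\<close> automatically lies over
    \<open>Ident B b\<close>, as \<open>F\<close> is \<open>G\<close> after \<open>P\<close>, so
    passing to the fibre of \<open>F\<close> loses nothing.\<close>
  moreover have "Hom_over (fibre X B F b) P ?id x' y' = Hom (fibre X M P (omap P y')) x' y'"
    using G1 by (auto simp: Hom_over_def Hom_def fibre_def simp flip: mmap_commute)
  ultimately show ?thesis
    by simp
qed

section \<open>Torsor structure on the arrows over \<open>\<phi>\<close>\<close>

theorem theorem3p5:
  fixes B :: "('ob, 'mb) category"
    and X :: "('ox, 'mx) category" and F :: "('ox, 'mx, 'ob, 'mb) ftor"
    and M :: "('om, 'mm) category" and G :: "('om, 'mm, 'ob, 'mb) ftor"
    and P :: "('ox, 'mx, 'om, 'mm) ftor"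
    and x y y_pull x_push :: 'ox and \<phi> \<phi>\<^sub>v :: 'mm and w u :: 'mx
  assumes "fibrewise_opfibration B X F M G P"
    and "\<And>m. m \<in> Obj M \<Longrightarrow> groupoid (fibre X M P m)"
    and "x \<in> Obj X" and "y \<in> Obj X"
    and "\<phi> \<in> Hom M (omap P x) (omap P y)"
    and "w \<in> Hom X y_pull y" and "cartesian X B F w" and "mmap F w = mmap G \<phi>"
    and "\<phi>\<^sub>v \<in> Hom (fibre M B G (omap F x)) (omap P x) (omap P y_pull)"
    and "\<phi> = mmap P w \<cdot>\<^bsub>M\<^esub> \<phi>\<^sub>v"
    and "u \<in> Hom (fibre X B F (omap F x)) x x_push"
    and "opcartesian (fibre X B F (omap F x)) (fibre M B G (omap F x)) P u"
    and "mmap P u = \<phi>\<^sub>v"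
  shows "let Y = fibre X M P (omap P y_pull);
             X\<phi> = Hom_over X P \<phi> x y;
             S = Hom Y x_push y_pull;
             \<tau> = (\<lambda>g. w \<cdot>\<^bsub>X\<^esub> g \<cdot>\<^bsub>X\<^esub> u)
         in (X\<phi> \<noteq> {} \<longleftrightarrow> isomorphic Y y_pull x_push) \<and>
            (X\<phi> \<noteq> {} \<longrightarrow>
               bij_betw \<tau> S X\<phi> \<and>
               torsor (endo_monoid Y y_pull) X\<phi>
                 (transport_action \<tau> S X\<phi> (left_comp_action Y x_push y_pull)))"
proof -
  interpret fibrewise_opfibration B X F M G P by fact
  let ?m = "omap P y_pull"
  let ?Y = "fibre X M P ?m"
  let ?E = "Hom_over X P \<phi> x y"
  let ?S = "Hom ?Y x_push y_pull"
  let ?\<tau> = "\<lambda>g. w \<cdot>\<^bsub>X\<^esub> g \<cdot>\<^bsub>X\<^esub> u"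
  note w = assms(6,7) and u = assms(11,12)
  have y_pull: "y_pull \<in> Obj X"
    using w(1) source.Dom_closed by (auto simp: Hom_def)
  have u': "u \<in> Hom_over X P \<phi>\<^sub>v x x_push"
    using u(1) assms(13) by (auto simp: Hom_fibre Hom_over_def)
  have \<phi>\<^sub>v: "\<phi>\<^sub>v \<in> Hom M (omap P x) ?m"
    using assms(9) by (simp add: Hom_fibre Hom_over_def)
  \<comment> \<open>Both sides are the codomain of \<open>\<phi>\<^sub>v\<close>, over which
    \<open>u\<close> lies.\<close>
  have x_push: "?m = omap P x_push"
    using mmap_in_Hom[of u x x_push] u' \<phi>\<^sub>v by (auto simp: Hom_over_def Hom_def)
  have bij: "bij_betw ?\<tau> ?S ?E"
  proof (rule bij_betwI')
    have gu: "g \<cdot>\<^bsub>X\<^esub> u \<in> Hom_over X P \<phi>\<^sub>v x y_pull" if "g \<in> ?S" for g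
      using Hom_over_Comp[OF u'] that target.Id_Comp[OF \<phi>\<^sub>v] by (metis Hom_fibre)
    have "w \<in> Hom_over X P (mmap P w) y_pull y"
      using w(1) by (simp add: Hom_over_def)
    from Hom_over_Comp[OF gu this]
    show \<tau>: "?\<tau> g \<in> ?E" if "g \<in> ?S" for g
      using that assms(10) by simp
    have fact_w: "\<exists>!k. k \<in> Hom_over X P \<phi>\<^sub>v x y_pull \<and> f = w \<cdot>\<^bsub>X\<^esub> k" if "f \<in> ?E" for f
      using cartesian_factorization[OF w assms(9,3) refl] that assms(10) by simp
    have fact_u: "\<exists>!g. g \<in> ?S \<and> k = g \<cdot>\<^bsub>X\<^esub> u" if "k \<in> Hom_over X P \<phi>\<^sub>v x y_pull" for k
      using opcartesian_factorization[OF u refl y_pull x_push] that assms(13) by simp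
    \<comment> \<open>Uniqueness in \<open>fact_w\<close> cancels \<open>w\<close> on the left, then
      uniqueness in \<open>fact_u\<close> cancels \<open>u\<close> on the right.\<close>
    show "?\<tau> g = ?\<tau> g' \<longleftrightarrow> g = g'" if "g \<in> ?S" "g' \<in> ?S" for g g'
      using fact_w[OF \<tau>] fact_u[OF gu] gu that by metis
    show "\<exists>g \<in> ?S. f = ?\<tau> g" if "f \<in> ?E" for f
      using fact_w[OF that] fact_u by metis
  qed
  interpret Y: groupoid ?Y
    using assms(2) omap_closed y_pull by blast
  \<comment> \<open>The bijection \<open>bij\<close> holds even for empty hom-sets, so it also
    decides emptiness; in the groupoid \<open>?Y\<close> this is the criterion by
    isomorphism.\<close>
  have E: "?E \<noteq> {} \<longleftrightarrow> ?S \<noteq> {}"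
    using bij by (auto simp: bij_betw_def)
  then show ?thesis
    unfolding Let_def Y.isomorphic_iff_Hom_nonempty
    using bij Y.torsor_left_comp_action torsor_transport[OF _ bij] by blast
qed

end
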